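(* Let $K$ be a compact Hausdorff space and let $F\subset C(K)$ be a filtered subalgebra with filtration $\{0\}\subset F_0\subseteq F_1\subseteq\cdots\subseteq F_d\subseteq\cdots\subseteq F$ such that $n_d:=\dim F_d<\infty$ for all $d$ and $F_0$ contains the constant functions on $K$. Suppose there are $c\in\mathbb R$ and $\{p_d\}_{d\in\mathbb N}\subset\mathbb N$ such that $$\frac{\ln n_{d\cdot p_d}}{p_d}\le c\quad\text{for all } d\in\mathbb N.$$ Then there exist linear injective maps $i_d: F_d\hookrightarrow \ell^\infty_{n_{d\cdot p_d}}$ such that $$d_{BM}(F_d, i_d(F_d))\le e^{c},\quad d\in\mathbb N.$$
   Context: $\mathbb N=\{1,2,\dots\}$, $\mathbb Z_+=\{0,1,2,\dots\}$. $C(K)$ is the Banach space of real continuous functions on a (nonempty) compact Hausdorff space $K$ with the supremum norm. A filtered subalgebra $F\subset C(K)$ is a subalgebra with linear subspaces $F_0\subseteq F_1\subseteq\cdots\subseteq F$ such that $F=\bigcup_{d\in\mathbb Z_+}F_d$ and $F_i\cdot F_j\subset F_{i+j}$ for all $i,j\in\mathbb Z_+$. Each $F_d$ carries the supremum norm of $C(K)$. $\ell^\infty_N$ is $\mathbb R^N$ with the maximum norm, and $i_d(F_d)$ carries the norm induced from $\ell^\infty_{n_{d\cdot p_d}}$. The Banach-Mazur distance between two $k$-dimensional real Banach spaces $E,G$ is $d_{BM}(E,G):=\inf\{\|u\|\cdot\|u^{-1}\|\}$, the infimum taken over all linear isomorphisms $u:E\to G$. *)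

theory Defs
  imports "HOL-Analysis.Analysis"
begin

text \<open>
  For a type \<open>'k\<close> of class \<open>t2_space\<close> with \<open>compact (UNIV :: 'k set)\<close>, every continuous real function
  is bounded, so \<open>'k \<Rightarrow>\<^sub>C real\<close>, the bounded continuous functions with the supremum norm, is
  the Banach space \<open>C(K)\<close>. The library gives it no product; we add the pointwise one.
\<close>

lemma mult_bcontfun:
  fixes f g :: "'a::topological_space \<Rightarrow>\<^sub>C 'b::real_normed_algebra"
  shows "(\<lambda>x. apply_bcontfun f x * apply_bcontfun g x) \<in> bcontfun"
proof -
  have "norm (apply_bcontfun f x * apply_bcontfun g x) \<le> norm f * norm g" for x
    by (rule order_trans[OF norm_mult_ineq
          mult_mono'[OF norm_bounded norm_bounded norm_ge_zero norm_ge_zero]])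
  then have "bounded (range (\<lambda>x. apply_bcontfun f x * apply_bcontfun g x))"
    by (auto simp: bounded_iff)
  then show ?thesis
    by (auto simp: bcontfun_def intro!: continuous_on_mult)
qed

instantiation bcontfun :: (topological_space, real_normed_algebra) real_normed_algebra
begin

definition times_bcontfun :: "'a \<Rightarrow>\<^sub>C 'b \<Rightarrow> 'a \<Rightarrow>\<^sub>C 'b \<Rightarrow> 'a \<Rightarrow>\<^sub>C 'b" where
  "f * g = Bcontfun (\<lambda>x. apply_bcontfun f x * apply_bcontfun g x)"

lemma apply_bcontfun_times [simp]:
  "apply_bcontfun (f * g) x = apply_bcontfun f x * apply_bcontfun g x"
  for f g :: "'a \<Rightarrow>\<^sub>C 'b"
  by (simp add: times_bcontfun_def Bcontfun_inverse mult_bcontfun)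

instance
proof
  fix f g h :: "'a \<Rightarrow>\<^sub>C 'b" and r :: real
  show "f * g * h = f * (g * h)"
    by (rule bcontfun_eqI) (simp add: mult.assoc)
  show "(f + g) * h = f * h + g * h"
    by (rule bcontfun_eqI) (simp add: plus_bcontfun.rep_eq distrib_right)
  show "f * (g + h) = f * g + f * h"
    by (rule bcontfun_eqI) (simp add: plus_bcontfun.rep_eq distrib_left)
  show "r *\<^sub>R f * g = r *\<^sub>R (f * g)"
    by (rule bcontfun_eqI) (simp add: scaleR_bcontfun.rep_eq)
  show "f * r *\<^sub>R g = r *\<^sub>R (f * g)"
    by (rule bcontfun_eqI) (simp add: scaleR_bcontfun.rep_eq)
  show "norm (f * g) \<le> norm f * norm g"
    by (rule norm_bound)
      (simp add:
        order_trans[OF norm_mult_ineq mult_mono'[OF norm_bounded norm_bounded]])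
qed

end

definition filtered_subalgebra ::
    "('k::topological_space \<Rightarrow>\<^sub>C real) set \<Rightarrow> (nat \<Rightarrow> ('k \<Rightarrow>\<^sub>C real) set) \<Rightarrow> bool" where
  "filtered_subalgebra A F \<longleftrightarrow>
     subspace A \<and> (\<forall>f\<in>A. \<forall>g\<in>A. f * g \<in> A) \<and>
     (\<forall>d. subspace (F d)) \<and> (\<forall>d. F d \<subseteq> F (Suc d)) \<and> A = (\<Union>d. F d) \<and>
     (\<forall>i j. \<forall>f\<in>F i. \<forall>g\<in>F j. f * g \<in> F (i + j))"

text \<open>Needed alongside \<open>dim\<close>, which is \<open>0\<close> on infinite-dimensional spaces.\<close>

definition finite_dim :: "'a::real_vector set \<Rightarrow> bool" where
  "finite_dim S \<longleftrightarrow> (\<exists>B. finite B \<and> span B = S)"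

definition linear_map_on :: "'a::real_vector set \<Rightarrow> ('a \<Rightarrow> 'b::real_vector) \<Rightarrow> bool" where
  "linear_map_on E u \<longleftrightarrow>
     (\<forall>x\<in>E. \<forall>y\<in>E. u (x + y) = u x + u y) \<and> (\<forall>r. \<forall>x\<in>E. u (r *\<^sub>R x) = r *\<^sub>R u x)"

text \<open>
  As \<open>onorm\<close>, but with the supremum over the subspace \<open>E\<close> only. Like \<open>onorm\<close>, it is meaningful
  only for bounded maps, hence for all linear maps if \<open>E\<close> is finite-dimensional.
\<close>

definition onorm_on :: "'a::real_normed_vector set \<Rightarrow> ('a \<Rightarrow> 'b::real_normed_vector) \<Rightarrow> real" where
  "onorm_on E u = (SUP x\<in>E. norm (u x) / norm x)"

text \<open>
  The Banach-Mazur distance of subspaces with the induced norms, meaningful for finite-dimensional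
  spaces of equal dimension (otherwise the infimum may be over the empty set).
\<close>

definition banach_mazur_dist ::
    "'a::real_normed_vector set \<Rightarrow> 'b::real_normed_vector set \<Rightarrow> real" where
  "banach_mazur_dist E G =
     Inf {onorm_on E u * onorm_on G (inv_into E u) | u. linear_map_on E u \<and> bij_betw u E G}"

text \<open>
  The space \<open>\<real>\<^sup>N\<close> with the maximum norm, for \<open>N\<close> varying inside a formula: since \<open>nat\<close> carries the
  discrete topology, \<open>nat \<Rightarrow>\<^sub>C real\<close> is the Banach space of all bounded sequences with the supremum
  norm, and we take the sequences supported in \<open>{..<N}\<close>.
\<close>

definition linf :: "nat \<Rightarrow> (nat \<Rightarrow>\<^sub>C real) set" where
  "linf N = {v. \<forall>j\<ge>N. apply_bcontfun v j = 0}"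

lemma linf_bij_betw:
  "bij_betw apply_bcontfun (linf N) {v :: nat \<Rightarrow> real. \<forall>j\<ge>N. v j = 0}"
proof (rule bij_betw_imageI)
  show "inj_on apply_bcontfun (linf N)"
    by (auto intro!: inj_onI simp: apply_bcontfun_inject)
  have "v \<in> apply_bcontfun ` linf N" if v: "\<forall>j\<ge>N. v j = 0" for v :: "nat \<Rightarrow> real"
  proof -
    have "range v \<subseteq> insert 0 (v ` {..<N})"
      using v by (metis imageI image_subsetI insertI1 insertI2 lessThan_iff not_less)
    then have "bounded (range v)"
      by (meson bounded_subset finite_imageI finite_imp_bounded finite_insert finite_lessThan)
    then have "v \<in> bcontfun"
      by (simp add: bcontfun_def)
    then obtain w where "v = apply_bcontfun w"
      by (rule bcontfunE)
    then show ?thesis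
      using v by (auto simp: linf_def)
  qed
  then show "apply_bcontfun ` linf N = {v :: nat \<Rightarrow> real. \<forall>j\<ge>N. v j = 0}"
    by (auto simp: linf_def)
qed

lemma norm_linf:
  assumes "v \<in> linf N" "N \<ge> 1"
  shows "norm v = Max ((\<lambda>j. \<bar>apply_bcontfun v j\<bar>) ` {..<N})"
proof (rule antisym)
  have *: "\<bar>apply_bcontfun v j\<bar> \<le> Max ((\<lambda>j. \<bar>apply_bcontfun v j\<bar>) ` {..<N})" if "j < N" for j
    using that by (intro Max_ge) auto
  have "\<bar>apply_bcontfun v j\<bar> \<le> Max ((\<lambda>j. \<bar>apply_bcontfun v j\<bar>) ` {..<N})" for j
  proof (cases "j < N")
    case False
    then have "apply_bcontfun v j = 0"
      using assms by (simp add: linf_def)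
    then show ?thesis
      using order_trans[OF abs_ge_zero *[of 0]] assms by simp
  qed (rule *)
  then show "norm v \<le> Max ((\<lambda>j. \<bar>apply_bcontfun v j\<bar>) ` {..<N})"
    by (intro norm_bound) simp
  show "Max ((\<lambda>j. \<bar>apply_bcontfun v j\<bar>) ` {..<N}) \<le> norm v"
    using assms norm_bounded[of v] by (subst Max_le_iff) (auto simp: lessThan_empty_iff)
qed

end

theory Submission
  imports Defs "Jordan_Normal_Form.Determinant"
begin

text \<open>
  Fix \<open>d \<ge> 1\<close> and write \<open>p = p d\<close>, \<open>N = dim (F (d * p))\<close>. The map \<open>i d\<close> evaluates a function at \<open>N\<close>
  Fekete points \<open>x\<^sub>0, \<dots>, x\<^sub>N\<^sub>-\<^sub>1\<close> of \<open>F (d * p)\<close>: points at which the modulus of the determinant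
  \<open>det (b\<^sub>i (x\<^sub>j))\<close>, for a basis \<open>b\<close> of \<open>F (d * p)\<close>, is maximal over \<open>K\<^sup>N\<close>. By maximality the
  associated Lagrange functions \<open>l\<^sub>j\<close>, which are quotients of such determinants, are bounded by \<open>1\<close>
  (\<open>fekete_system_exists\<close>). So for every \<open>g\<close> in \<open>F (d * p)\<close> the expansion
  \<open>g = (\<Sum>j. g (x\<^sub>j) l\<^sub>j)\<close> gives \<open>norm g \<le> N * max\<^sub>j \<bar>g (x\<^sub>j)\<bar>\<close>. If \<open>f\<close> is in \<open>F d\<close>, then \<open>f\<^sup>p\<close> is in
  \<open>F (d * p)\<close>, and applying this to \<open>g = f\<^sup>p\<close> and taking \<open>p\<close>-th roots gives
  \<open>norm f \<le> N powr (1 / p) * max\<^sub>j \<bar>f (x\<^sub>j)\<bar> \<le> exp c * max\<^sub>j \<bar>f (x\<^sub>j)\<bar>\<close>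
  (\<open>norm_le_exp_mult_sup_on_nodes\<close>). Hence evaluation is injective and of norm at most \<open>1\<close>, and its
  inverse has norm at most \<open>exp c\<close>.

  The Banach-Mazur distance is an infimum of reals over all linear bijections, so one witness bounds
  it only if the products of norms are bounded below. They are nonnegative, but since the supremum
  of an unbounded set of reals is unspecified, this rests on every linear map on a
  finite-dimensional space of functions being bounded (\<open>bounded_linear_map_on\<close>). That, too, follows
  by expanding along a Lagrange system; no bound on the \<open>l\<^sub>j\<close> and no compactness is needed, so it
  also covers the inverse maps, which are defined on subspaces of \<open>nat \<Rightarrow>\<^sub>C real\<close>.
\<close>

section \<open>Lagrange systems in spaces of bounded continuous functions\<close>

lemma apply_bcontfun_sum:
  fixes h :: "'i \<Rightarrow> ('a::topological_space \<Rightarrow>\<^sub>C 'b::real_normed_vector)"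
  shows "apply_bcontfun (\<Sum>i\<in>I. h i) t = (\<Sum>i\<in>I. apply_bcontfun (h i) t)"
  by (induction I rule: infinite_finite_induct) auto

text \<open>
  Nodes \<open>x 0, \<dots>, x (k - 1)\<close> with functions \<open>l 0, \<dots>, l (k - 1)\<close> in \<open>E\<close> that are biorthogonal to
  evaluation at the nodes. Neither the spanning of \<open>E\<close> by the \<open>l j\<close> nor any norm bound is part of
  the notion; the values of \<open>x\<close> and \<open>l\<close> at indices from \<open>k\<close> on are irrelevant.
\<close>

definition lagrange_system ::
    "('a::topological_space \<Rightarrow>\<^sub>C real) set \<Rightarrow> nat \<Rightarrow> (nat \<Rightarrow> 'a) \<Rightarrow> (nat \<Rightarrow> ('a \<Rightarrow>\<^sub>C real)) \<Rightarrow> bool" where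
  "lagrange_system E k x l \<longleftrightarrow>
     (\<forall>j<k. l j \<in> E) \<and>
     (\<forall>i<k. \<forall>j<k. apply_bcontfun (l j) (x i) = (if i = j then 1 else 0))"

lemma lagrange_system_eval_sum:
  assumes "lagrange_system E k x l" "i < k"
  shows "apply_bcontfun (\<Sum>j<k. a j *\<^sub>R l j) (x i) = a i"
proof -
  have "apply_bcontfun (\<Sum>j<k. a j *\<^sub>R l j) (x i) = (\<Sum>j<k. if i = j then a j else 0)"
    using assms unfolding apply_bcontfun_sum lagrange_system_def
    by (intro sum.cong) auto
  then show ?thesis
    using assms by simp
qed

lemma lagrange_system_le_dim:
  assumes "lagrange_system E k x l" "finite_dim E"
  shows "k \<le> dim E"
proof -
  have inj: "inj_on l {..<k}"
  proof (rule inj_onI)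
    fix i j assume "i \<in> {..<k}" "j \<in> {..<k}" "l i = l j"
    then have "apply_bcontfun (l j) (x i) = 1" "i < k" "j < k"
      using assms(1) unfolding lagrange_system_def by (metis lessThan_iff)+
    then show "i = j"
      using assms(1) unfolding lagrange_system_def by (metis zero_neq_one)
  qed
  have "independent (l ` {..<k})"
  proof (rule real_vector.independent_if_scalars_zero)
    fix u v assume z: "(\<Sum>v\<in>l ` {..<k}. u v *\<^sub>R v) = 0" and "v \<in> l ` {..<k}"
    then obtain i where i: "i < k" "v = l i" by auto
    have "(\<Sum>j<k. u (l j) *\<^sub>R l j) = 0"
      using z by (simp add: sum.reindex[OF inj])
    then show "u v = 0"
      using lagrange_system_eval_sum[OF assms(1) i(1), of "\<lambda>j. u (l j)"] i by simp
  qed simp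
  moreover have "l ` {..<k} \<subseteq> E"
    using assms(1) by (auto simp: lagrange_system_def)
  moreover obtain C where "finite C" "span C = E"
    using assms(2) by (auto simp: finite_dim_def)
  ultimately obtain B where B: "l ` {..<k} \<subseteq> B" "B \<subseteq> E" "independent B" "E \<subseteq> span B" "finite B"
    using real_vector.maximal_independent_subset_extend[of "l ` {..<k}" E]
      real_vector.independent_span_bound[of C]
    by metis
  then have "card B = dim E"
    by (simp add: real_vector.basis_card_eq_dim)
  then show ?thesis
    using card_mono[OF B(5,1)] by (simp add: card_image[OF inj])
qed

text \<open>
  One Newton interpolation step: a function of \<open>E\<close> that differs from its interpolant yields a new
  node and a system with one more member.
\<close>

lemma lagrange_system_extend:
  assumes L: "lagrange_system E k x l" and E: "subspace E" and g: "g \<in> E"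
    and ne: "g \<noteq> (\<Sum>j<k. apply_bcontfun g (x j) *\<^sub>R l j)"
  shows "\<exists>x' l'. lagrange_system E (Suc k) x' l'"
proof -
  define h where "h = g - (\<Sum>j<k. apply_bcontfun g (x j) *\<^sub>R l j)"
  have lE: "l j \<in> E" if "j < k" for j
    using L that by (simp add: lagrange_system_def)
  have hE: "h \<in> E"
    unfolding h_def using E g lE
    by (intro subspace_diff subspace_sum subspace_scale) auto
  have h0: "apply_bcontfun h (x i) = 0" if "i < k" for i
    using lagrange_system_eval_sum[OF L that] by (simp add: h_def)
  have "h \<noteq> 0" using ne by (simp add: h_def)
  then obtain t where t: "apply_bcontfun h t \<noteq> 0"
    by (metis bcontfun_eqI zero_bcontfun.rep_eq)
  define m where "m = (1 / apply_bcontfun h t) *\<^sub>R h"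
  have m: "m \<in> E" "apply_bcontfun m t = 1" "\<And>i. i < k \<Longrightarrow> apply_bcontfun m (x i) = 0"
    using E hE h0 t by (auto simp: m_def subspace_scale)
  have "lagrange_system E (Suc k) (x(k := t))
     (\<lambda>j. if j < k then l j - apply_bcontfun (l j) t *\<^sub>R m else m)"
    unfolding lagrange_system_def using m lE L E
    by (auto simp: less_Suc_eq lagrange_system_def subspace_diff subspace_scale)
  then show ?thesis by blast
qed

lemma lagrange_system_expansion:
  assumes "lagrange_system E (dim E) x l" "subspace E" "finite_dim E" "g \<in> E"
  shows "g = (\<Sum>j<dim E. apply_bcontfun g (x j) *\<^sub>R l j)"
  using lagrange_system_extend[OF assms(1,2,4)] lagrange_system_le_dim[OF _ assms(3)]
  by (meson Suc_n_not_le_n)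

lemma lagrange_system_exists:
  assumes "subspace E" "finite_dim E"
  shows "\<exists>x l. lagrange_system E (dim E) x l"
proof -
  have "\<exists>x l. lagrange_system E k x l" if "k \<le> dim E" for k
    using that
  proof (induction k)
    case 0
    show ?case by (simp add: lagrange_system_def)
  next
    case (Suc k)
    then obtain x l where L: "lagrange_system E k x l" by auto
    have "\<exists>g\<in>E. g \<noteq> (\<Sum>j<k. apply_bcontfun g (x j) *\<^sub>R l j)"
    proof (rule ccontr)
      assume "\<not> ?thesis"
      then have "g \<in> span (l ` {..<k})" if "g \<in> E" for g
        using that
        by (metis (no_types, lifting) imageI span_base span_scale span_sum)
      then have "dim E \<le> card (l ` {..<k})"
        by (intro real_vector.dim_le_card) auto
      also have "\<dots> \<le> k"
        using card_image_le[of "{..<k}" l] by simp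
      finally show False using Suc.prems by simp
    qed
    then show ?case
      using lagrange_system_extend[OF L assms(1)] by blast
  qed
  then show ?thesis by blast
qed

section \<open>Fekete points\<close>

text \<open>
  The generalised Vandermonde matrix of the functions \<open>b\<close> at the points \<open>y\<close>. The points form a
  sequence of which only the first \<open>n\<close> terms are used, so that its determinant is a function on the
  product \<open>nat \<Rightarrow> 'a\<close>, which is compact if \<open>'a\<close> is.
\<close>

definition eval_mat :: "nat \<Rightarrow> (nat \<Rightarrow> ('a::topological_space \<Rightarrow>\<^sub>C real)) \<Rightarrow> (nat \<Rightarrow> 'a) \<Rightarrow> real mat" where
  "eval_mat n b y = mat n n (\<lambda>(i, j). apply_bcontfun (b i) (y j))"

lemma eval_mat_carrier [simp]: "eval_mat n b y \<in> carrier_mat n n"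
  by (simp add: eval_mat_def)

lemma continuous_on_det_eval_mat: "continuous_on S (\<lambda>y. det (eval_mat n b y))"
proof -
  have "continuous_on S (\<lambda>y. apply_bcontfun (b i) (y j))" for i j
    by (rule continuous_on_compose2[OF continuous_on_apply_bcontfun[of UNIV]])
      (auto intro: continuous_on_subset[OF continuous_on_product_coordinates])
  moreover have "det (eval_mat n b y) = (\<Sum>\<pi> | \<pi> permutes {0..<n}.
      signof \<pi> * (\<Prod>i = 0..<n. apply_bcontfun (b i) (y (\<pi> i))))" for y
    unfolding det_def'[OF eval_mat_carrier]
    by (intro sum.cong prod.cong arg_cong2[where f = "(*)"])
      (auto simp: eval_mat_def permutes_in_image)
  ultimately show ?thesis
    by (simp only:) (intro continuous_on_sum continuous_on_mult continuous_on_prod continuous_on_const; simp)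
qed

lemma compact_UNIV_fun:
  assumes "compact (UNIV :: 'a::topological_space set)"
  shows "compact (UNIV :: ('i \<Rightarrow> 'a) set)"
proof -
  have "compact_space (euclidean :: 'a topology)"
    using assms by (simp add: compact_space_def)
  then have "compact_space (product_topology (\<lambda>_::'i. euclidean :: 'a topology) UNIV)"
    by (simp add: compact_space_product_topology)
  then show ?thesis
    by (simp add: euclidean_product_topology compact_space_def)
qed

text \<open>Laplace expansion along the column of a node that is allowed to move.\<close>

lemma det_eval_mat_update:
  assumes "j < n"
  shows "det (eval_mat n b (y(j := t))) =
    (\<Sum>i<n. apply_bcontfun (b i) t * cofactor (eval_mat n b y) i j)"
proof -
  have "mat_delete (eval_mat n b (y(j := t))) i j = mat_delete (eval_mat n b y) i j" for i
    by (rule eq_matI) (auto simp: mat_delete_def eval_mat_def)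
  then show ?thesis
    using assms
    by (subst laplace_expansion_column[OF eval_mat_carrier assms])
      (auto simp: cofactor_def eval_mat_def)
qed

text \<open>
  On a compact space the nodes can be chosen such that the Lagrange functions are bounded by \<open>1\<close>:
  \<open>l j t\<close> is the ratio of the determinants at \<open>x (j := t)\<close> and at \<open>x\<close>, and \<open>x\<close> maximises the modulus.
\<close>

lemma fekete_system_exists:
  fixes E :: "('a::topological_space \<Rightarrow>\<^sub>C real) set"
  assumes "compact (UNIV :: 'a set)" "subspace E" "finite_dim E"
  shows "\<exists>x l. lagrange_system E (dim E) x l \<and> (\<forall>j<dim E. \<forall>t. \<bar>apply_bcontfun (l j) t\<bar> \<le> 1)"
proof -
  define n where "n = dim E"
  obtain z b where b: "lagrange_system E n z b"
    using lagrange_system_exists[OF assms(2,3)] by (auto simp: n_def)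
  define V where "V y = det (eval_mat n b y)" for y
  have "continuous_on UNIV (\<lambda>y. \<bar>V y\<bar>)"
    unfolding V_def by (intro continuous_on_rabs continuous_on_det_eval_mat)
  then obtain x where x: "\<And>y. \<bar>V y\<bar> \<le> \<bar>V x\<bar>"
    using continuous_attains_sup[OF compact_UNIV_fun[OF assms(1)]] by blast
  \<comment> \<open>The basis is itself a Lagrange system, so the determinant is \<open>1\<close> at its own nodes.\<close>
  have "eval_mat n b z = 1\<^sub>m n"
    using b by (intro eq_matI) (auto simp: eval_mat_def lagrange_system_def)
  then have "V z = 1"
    by (simp add: V_def)
  then have Vx: "V x \<noteq> 0"
    using x[of z] by auto
  define l where "l j = (\<Sum>i<n. (cofactor (eval_mat n b x) i j / V x) *\<^sub>R b i)" for j
  have l: "apply_bcontfun (l j) t = V (x(j := t)) / V x" if "j < n" for j t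
    by (simp add: V_def l_def det_eval_mat_update[OF that] apply_bcontfun_sum sum_divide_distrib
        mult.commute)
  have "V (x(j := x i)) = 0" if "i < n" "j < n" "i \<noteq> j" for i j
    unfolding V_def using that
    by (intro det_identical_columns[OF eval_mat_carrier that(3,1,2)] eq_vecI)
      (auto simp: eval_mat_def)
  moreover have "l j \<in> E" for j
    unfolding l_def using assms(2) b
    by (intro subspace_sum subspace_scale) (auto simp: lagrange_system_def)
  ultimately have "lagrange_system E n x l"
    using Vx by (auto simp: lagrange_system_def l)
  moreover have "\<bar>apply_bcontfun (l j) t\<bar> \<le> 1" if "j < n" for j t
    using x[of "x(j := t)"] Vx by (simp add: l[OF that] divide_le_eq)
  ultimately show ?thesis
    unfolding n_def by blast
qed

section \<open>Linear maps on finite-dimensional function spaces\<close>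

lemma linear_map_on_sum:
  assumes "linear_map_on E u" "subspace E" "finite I" "\<And>j. j \<in> I \<Longrightarrow> l j \<in> E"
  shows "u (\<Sum>j\<in>I. a j *\<^sub>R l j) = (\<Sum>j\<in>I. a j *\<^sub>R u (l j))"
  using assms(3,4)
proof (induction I rule: finite_induct)
  case empty
  have "u (0 *\<^sub>R 0) = 0 *\<^sub>R u 0"
    using assms(1,2) unfolding linear_map_on_def by (meson subspace_0)
  then show ?case by simp
next
  case (insert i I)
  have "a i *\<^sub>R l i \<in> E" "(\<Sum>j\<in>I. a j *\<^sub>R l j) \<in> E"
    using insert.prems assms(2) by (auto intro!: subspace_sum subspace_scale)
  then show ?case
    using insert assms(1) by (simp add: linear_map_on_def)
qed

lemma linear_map_on_expansion:
  assumes "linear_map_on E u" "subspace E" "finite_dim E" "lagrange_system E (dim E) x l" "f \<in> E"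
  shows "u f = (\<Sum>j<dim E. apply_bcontfun f (x j) *\<^sub>R u (l j))"
  using linear_map_on_sum[OF assms(1,2), of "{..<dim E}" l "\<lambda>j. apply_bcontfun f (x j)"]
    lagrange_system_expansion[OF assms(4,2,3,5)] assms(4)
  by (simp add: lagrange_system_def)

lemma bounded_linear_map_on:
  fixes u :: "('a::topological_space \<Rightarrow>\<^sub>C real) \<Rightarrow> 'b::real_normed_vector"
  assumes "linear_map_on E u" "subspace E" "finite_dim E"
  shows "\<exists>C. \<forall>f\<in>E. norm (u f) \<le> C * norm f"
proof -
  obtain x l where L: "lagrange_system E (dim E) x l"
    using lagrange_system_exists[OF assms(2,3)] by blast
  have "norm (u f) \<le> (\<Sum>j<dim E. norm (u (l j))) * norm f" if "f \<in> E" for f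
  proof -
    have "norm (u f) \<le> (\<Sum>j<dim E. norm (apply_bcontfun f (x j) *\<^sub>R u (l j)))"
      by (subst linear_map_on_expansion[OF assms L that]) (rule norm_sum)
    also have "\<dots> \<le> (\<Sum>j<dim E. norm (u (l j)) * norm f)"
      using norm_bounded[of f]
      by (intro sum_mono) (simp add: mult.commute[of "norm (u _)"] mult_right_mono)
    finally show ?thesis by (simp add: sum_distrib_right)
  qed
  then show ?thesis by blast
qed

lemma onorm_on_nonneg:
  fixes u :: "('a::topological_space \<Rightarrow>\<^sub>C real) \<Rightarrow> 'b::real_normed_vector"
  assumes "linear_map_on E u" "subspace E" "finite_dim E"
  shows "0 \<le> onorm_on E u"
proof -
  obtain C where C: "\<forall>f\<in>E. norm (u f) \<le> C * norm f"
    using bounded_linear_map_on[OF assms] by blast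
  have "norm (u f) / norm f \<le> max C 0" if "f \<in> E" for f
    using C that by (cases "f = 0") (auto simp: divide_le_eq le_max_iff_disj)
  then have "bdd_above ((\<lambda>f. norm (u f) / norm f) ` E)"
    by (auto simp: bdd_above_def)
  then have "norm (u 0) / norm (0 :: 'a \<Rightarrow>\<^sub>C real) \<le> onorm_on E u"
    unfolding onorm_on_def using assms(2) by (intro cSUP_upper) (auto simp: subspace_0)
  then show ?thesis by simp
qed

lemma onorm_on_le:
  assumes "E \<noteq> {}" "0 \<le> C" "\<And>f. f \<in> E \<Longrightarrow> norm (u f) \<le> C * norm f"
  shows "onorm_on E u \<le> C"
  unfolding onorm_on_def
proof (rule cSUP_least[OF assms(1)])
  fix f assume "f \<in> E"
  then show "norm (u f) / norm f \<le> C"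
    using assms(2,3) by (cases "f = 0") (auto simp: divide_le_eq)
qed

lemma subspace_linear_map_on_image:
  assumes "linear_map_on E u" "subspace E"
  shows "subspace (u ` E)"
proof (rule subspaceI)
  have "u 0 = 0"
    using linear_map_on_sum[OF assms, of "{}"] by simp
  then show "0 \<in> u ` E"
    using assms(2) by (metis imageI subspace_0)
  show "v + w \<in> u ` E" if vw: "v \<in> u ` E" "w \<in> u ` E" for v w
  proof -
    obtain f g where "f \<in> E" "g \<in> E" "v = u f" "w = u g"
      using vw by blast
    then have "u (f + g) = v + w" "f + g \<in> E"
      using assms by (auto simp: linear_map_on_def subspace_add)
    then show ?thesis by (metis imageI)
  qed
  show "r *\<^sub>R v \<in> u ` E" if v: "v \<in> u ` E" for r v
  proof -
    obtain f where "f \<in> E" "v = u f"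
      using v by blast
    then have "u (r *\<^sub>R f) = r *\<^sub>R v" "r *\<^sub>R f \<in> E"
      using assms by (auto simp: linear_map_on_def subspace_scale)
    then show ?thesis by (metis imageI)
  qed
qed

lemma finite_dim_linear_map_on_image:
  fixes E :: "('a::topological_space \<Rightarrow>\<^sub>C real) set"
  assumes "linear_map_on E u" "subspace E" "finite_dim E"
  shows "finite_dim (u ` E)"
proof -
  obtain x l where L: "lagrange_system E (dim E) x l"
    using lagrange_system_exists[OF assms(2,3)] by blast
  have "u f \<in> span ((\<lambda>j. u (l j)) ` {..<dim E})" if "f \<in> E" for f
    unfolding linear_map_on_expansion[OF assms L that]
    by (intro span_sum span_scale span_base) auto
  moreover have "span ((\<lambda>j. u (l j)) ` {..<dim E}) \<subseteq> u ` E"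
    using L subspace_linear_map_on_image[OF assms(1,2)]
    by (intro span_minimal) (auto simp: lagrange_system_def)
  ultimately have "span ((\<lambda>j. u (l j)) ` {..<dim E}) = u ` E"
    by blast
  then show ?thesis
    unfolding finite_dim_def by (metis finite_imageI finite_lessThan)
qed

lemma linear_map_on_inv_into:
  assumes "linear_map_on E u" "subspace E" "bij_betw u E G"
  shows "linear_map_on G (inv_into E u)"
proof -
  have inj: "inj_on u E" and im: "u ` E = G"
    using assms(3) by (auto simp: bij_betw_def)
  have "inv_into E u (u f + u g) = f + g" if "f \<in> E" "g \<in> E" for f g
    using that assms(1,2) inv_into_f_f[OF inj, of "f + g"]
    by (simp add: linear_map_on_def subspace_add)
  moreover have "inv_into E u (r *\<^sub>R u f) = r *\<^sub>R f" if "f \<in> E" for f r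
    using that assms(1,2) inv_into_f_f[OF inj, of "r *\<^sub>R f"]
    by (simp add: linear_map_on_def subspace_scale)
  ultimately show ?thesis
    unfolding linear_map_on_def im[symmetric] by (auto simp: inv_into_f_f[OF inj])
qed

lemma banach_mazur_dist_le:
  fixes E :: "('a::topological_space \<Rightarrow>\<^sub>C real) set" and G :: "('b::topological_space \<Rightarrow>\<^sub>C real) set"
  assumes E: "subspace E" "finite_dim E" and G: "subspace G" "finite_dim G"
    and u: "linear_map_on E u" "bij_betw u E G"
  shows "banach_mazur_dist E G \<le> onorm_on E u * onorm_on G (inv_into E u)"
  unfolding banach_mazur_dist_def
proof (rule cInf_lower)
  show "bdd_below {onorm_on E u * onorm_on G (inv_into E u) |u. linear_map_on E u \<and> bij_betw u E G}"
    using onorm_on_nonneg[OF _ E] onorm_on_nonneg[OF linear_map_on_inv_into[OF _ E(1)] G]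
    by (intro bdd_belowI[of _ 0]) (auto intro!: mult_nonneg_nonneg)
qed (use u in blast)

section \<open>Evaluation at Fekete points\<close>

lemma filtered_power_exists:
  assumes "filtered_subalgebra A F" "const_bcontfun 1 \<in> F 0" "f \<in> F d"
  shows "\<exists>g\<in>F (d * n). \<forall>t. apply_bcontfun g t = apply_bcontfun f t ^ n"
proof (induction n)
  case 0
  show ?case using assms(2) by (auto intro!: bexI[of _ "const_bcontfun 1"])
next
  case (Suc n)
  then obtain g where g: "g \<in> F (d * n)" "\<And>t. apply_bcontfun g t = apply_bcontfun f t ^ n"
    by blast
  have "f * g \<in> F (d * Suc n)"
    using assms(1,3) g(1) by (simp add: filtered_subalgebra_def)
  then show ?case
    using g(2) by (intro bexI[of _ "f * g"]) simp_all
qed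

text \<open>
  The main estimate, where \<open>E\<close> is the space that contains the power of \<open>f\<close>: passing to the \<open>p\<close>-th
  power reduces the loss from \<open>dim E\<close> to its \<open>p\<close>-th root.
\<close>

lemma norm_le_exp_mult_sup_on_nodes:
  fixes f :: "'a::topological_space \<Rightarrow>\<^sub>C real"
  assumes E: "subspace E" "finite_dim E"
    and L: "lagrange_system E (dim E) x l" "\<And>j t. j < dim E \<Longrightarrow> \<bar>apply_bcontfun (l j) t\<bar> \<le> 1"
    and g: "g \<in> E" "\<And>t. apply_bcontfun g t = apply_bcontfun f t ^ p"
    and p: "p \<ge> 1" and dim: "dim E \<ge> 1" "ln (real (dim E)) / real p \<le> c"
    and M: "0 \<le> M" "\<And>j. j < dim E \<Longrightarrow> \<bar>apply_bcontfun f (x j)\<bar> \<le> M"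
  shows "norm f \<le> exp c * M"
proof (rule norm_bound)
  fix t
  have "ln (real (dim E)) \<le> real p * c"
    using dim p by (simp add: divide_le_eq mult.commute)
  then have "exp (ln (real (dim E))) \<le> exp (real p * c)"
    by simp
  then have N: "real (dim E) \<le> exp c ^ p"
    using dim(1) by (simp add: exp_of_nat_mult)
  have "\<bar>apply_bcontfun f t\<bar> ^ p = \<bar>apply_bcontfun g t\<bar>"
    by (simp add: g power_abs)
  also have "\<dots> = \<bar>\<Sum>j<dim E. apply_bcontfun g (x j) * apply_bcontfun (l j) t\<bar>"
    by (subst lagrange_system_expansion[OF L(1) E g(1)]) (simp add: apply_bcontfun_sum)
  also have "\<dots> \<le> (\<Sum>j<dim E. M ^ p)"
  proof (rule order_trans[OF sum_abs sum_mono])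
    fix j assume "j \<in> {..<dim E}"
    then have "\<bar>apply_bcontfun f (x j)\<bar> ^ p * \<bar>apply_bcontfun (l j) t\<bar> \<le> M ^ p * 1"
      using L(2) M by (intro mult_mono power_mono) auto
    then show "\<bar>apply_bcontfun g (x j) * apply_bcontfun (l j) t\<bar> \<le> M ^ p"
      by (simp add: g abs_mult power_abs)
  qed
  also have "\<dots> \<le> (exp c * M) ^ p"
    using N M by (simp add: power_mult_distrib mult_right_mono)
  finally show "norm (apply_bcontfun f t) \<le> exp c * M"
    using p M by (simp add: power_mono_iff)
qed

text \<open>Evaluation at the first \<open>n\<close> nodes, padded with zeros, as a map into \<open>linf n\<close>.\<close>

definition eval_nodes :: "nat \<Rightarrow> (nat \<Rightarrow> 'a) \<Rightarrow> ('a::topological_space \<Rightarrow>\<^sub>C real) \<Rightarrow> (nat \<Rightarrow>\<^sub>C real)" where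
  "eval_nodes n x f = Bcontfun (\<lambda>j. if j < n then apply_bcontfun f (x j) else 0)"

lemma apply_eval_nodes [simp]:
  "apply_bcontfun (eval_nodes n x f) j = (if j < n then apply_bcontfun f (x j) else 0)"
proof -
  have "(\<lambda>j. if j < n then apply_bcontfun f (x j) else 0) \<in> bcontfun"
    using norm_bounded[of f] by (auto simp: bcontfun_def bounded_iff intro!: exI[of _ "norm f"])
  then show ?thesis
    by (simp add: eval_nodes_def Bcontfun_inverse)
qed

lemma linear_map_on_eval_nodes: "linear_map_on E (eval_nodes n x)"
  by (auto simp: linear_map_on_def intro!: bcontfun_eqI)

lemma norm_eval_nodes_le: "norm (eval_nodes n x f) \<le> norm f"
  using norm_bounded[of f] by (intro norm_bound) auto

text \<open>Evaluation never increases the norm, so the distance is controlled by its inverse alone.\<close>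

lemma eval_nodes_embedding:
  fixes E :: "('a::topological_space \<Rightarrow>\<^sub>C real) set"
  assumes E: "subspace E" "finite_dim E" and C: "0 \<le> C"
    and le: "\<And>f. f \<in> E \<Longrightarrow> norm f \<le> C * norm (eval_nodes n x f)"
  shows "inj_on (eval_nodes n x) E"
    and "banach_mazur_dist E (eval_nodes n x ` E) \<le> C"
proof -
  let ?u = "eval_nodes n x" let ?G = "?u ` E"
  note lin = linear_map_on_eval_nodes[of E n x]
  show inj: "inj_on ?u E"
  proof (rule inj_onI)
    fix f g assume fg: "f \<in> E" "g \<in> E" "?u f = ?u g"
    have "?u (f - g) = ?u f - ?u g"
      by (rule bcontfun_eqI) simp
    then show "f = g"
      using le[of "f - g"] fg subspace_diff[OF E(1)] by simp
  qed
  have G: "subspace ?G" "finite_dim ?G"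
    using lin E by (auto intro: subspace_linear_map_on_image finite_dim_linear_map_on_image)
  have bij: "bij_betw ?u E ?G"
    using inj by (simp add: bij_betw_def)
  have ne: "E \<noteq> {}"
    using E(1) subspace_0 by blast
  have "onorm_on E ?u \<le> 1"
    using norm_eval_nodes_le[of n x] ne by (intro onorm_on_le) auto
  moreover have "onorm_on ?G (inv_into E ?u) \<le> C"
    using le ne C by (intro onorm_on_le) (auto simp: inv_into_f_f[OF inj])
  ultimately have "onorm_on E ?u * onorm_on ?G (inv_into E ?u) \<le> 1 * C"
    using onorm_on_nonneg[OF linear_map_on_inv_into[OF lin E(1) bij] G] by (intro mult_mono) auto
  then show "banach_mazur_dist E ?G \<le> C"
    using banach_mazur_dist_le[OF E G lin bij] by simp
qed

theorem theorem1p1: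
  fixes A :: "('k::t2_space \<Rightarrow>\<^sub>C real) set"
    and F :: "nat \<Rightarrow> ('k \<Rightarrow>\<^sub>C real) set"
    and p :: "nat \<Rightarrow> nat" and c :: real
  assumes "compact (UNIV :: 'k set)"
    and "filtered_subalgebra A F"
    and "\<forall>d. finite_dim (F d)"
    and "\<forall>a::real. const_bcontfun a \<in> F 0"
    and "\<forall>d\<ge>1. p d \<ge> 1"
    and "\<forall>d\<ge>1. ln (real (dim (F (d * p d)))) / real (p d) \<le> c"
  shows "\<exists>i :: nat \<Rightarrow> ('k \<Rightarrow>\<^sub>C real) \<Rightarrow> (nat \<Rightarrow>\<^sub>C real). \<forall>d\<ge>1.
           linear_map_on (F d) (i d) \<and> inj_on (i d) (F d) \<and>
           i d ` F d \<subseteq> linf (dim (F (d * p d))) \<and>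
           banach_mazur_dist (F d) (i d ` F d) \<le> exp c"
proof -
  have sub: "subspace (F d)" and fin: "finite_dim (F d)" for d
    using assms(2,3) by (auto simp: filtered_subalgebra_def)
  have one: "const_bcontfun 1 \<in> F 0"
    using assms(4) by blast
  have "\<exists>u. linear_map_on (F d) u \<and> inj_on u (F d) \<and> u ` F d \<subseteq> linf (dim (F (d * p d))) \<and>
      banach_mazur_dist (F d) (u ` F d) \<le> exp c" if d: "d \<ge> 1" for d
  proof -
    let ?E = "F (d * p d)" let ?N = "dim (F (d * p d))"
    obtain x l where L: "lagrange_system ?E ?N x l"
      and l1: "\<And>j t. j < ?N \<Longrightarrow> \<bar>apply_bcontfun (l j) t\<bar> \<le> 1"
      using fekete_system_exists[OF assms(1) sub fin] by blast
    \<comment> \<open>The constants lie in every \<open>F d\<close>, so \<open>?N\<close> is positive and its logarithm is meaningful.\<close>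
    have N: "?N \<ge> 1"
    proof (rule ccontr)
      assume "\<not> 1 \<le> ?N"
      then have "?N = 0" by simp
      moreover have "F 0 \<subseteq> ?E"
        using assms(2) lift_Suc_mono_le[of F 0 "d * p d"] by (simp add: filtered_subalgebra_def)
      ultimately have "(const_bcontfun 1 :: 'k \<Rightarrow>\<^sub>C real) = 0"
        using lagrange_system_expansion[OF L sub fin, of "const_bcontfun 1"] one
        by (metis lessThan_0 subsetD sum.empty)
      then have "apply_bcontfun (const_bcontfun 1 :: 'k \<Rightarrow>\<^sub>C real) undefined = 0"
        by (simp only: zero_bcontfun.rep_eq)
      then show False by simp
    qed
    have "norm f \<le> exp c * norm (eval_nodes ?N x f)" if f: "f \<in> F d" for f
    proof -
      obtain g where "g \<in> ?E" "\<And>t. apply_bcontfun g t = apply_bcontfun f t ^ p d"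
        using filtered_power_exists[OF assms(2) one f] by blast
      moreover have "\<bar>apply_bcontfun f (x j)\<bar> \<le> norm (eval_nodes ?N x f)" if "j < ?N" for j
        using norm_bounded[of "eval_nodes ?N x f" j] that by simp
      ultimately show ?thesis
        using assms(5,6) d N l1
        by (intro norm_le_exp_mult_sup_on_nodes[where p = "p d", OF sub fin L]) auto
    qed
    then have "inj_on (eval_nodes ?N x) (F d)"
      and "banach_mazur_dist (F d) (eval_nodes ?N x ` F d) \<le> exp c"
      using eval_nodes_embedding[OF sub fin exp_ge_zero] by blast+
    moreover have "eval_nodes ?N x ` F d \<subseteq> linf ?N"
      by (auto simp: linf_def)
    ultimately show ?thesis
      using linear_map_on_eval_nodes by blast
  qed
  then show ?thesis by metis
qed

end
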